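(* For every non-negative integer $\ell$ there exists a finite undirected graph $G_\ell$ that contains an isometric path of length $\ell$ but contains no avoidable isometric path of length $\ell$.
   Context: Graphs are finite and undirected (loops and multiple edges are allowed). The distance $d_G(u,v)$ is the length of a shortest $u,v$-path in $G$ (and $\infty$ if none exists). A subgraph $H$ of $G$ is isometric in $G$ if $d_H(u,v)=d_G(u,v)$ for all $u,v\in V(H)$. An isometric path is a path $(v_1,e_1,v_2,\ldots,e_{k-1},v_k)$ (distinct vertices, $k\ge1$, length $k-1$) whose corresponding subgraph is isometric in $G$; an isometric cycle is a cycle of $G$ whose corresponding subgraph is isometric in $G$. An (isometric) extension of an isometric path $P=(v_1,e_1,\ldots,e_{k-1},v_k)$ is an isometric path in $G$ of the form $(v_0,e_0,v_1,e_1,\ldots,e_{k-1},v_k,e_k,v_{k+1})$. An isometric path is closable if it is contained, as a contiguous subpath, in an isometric cycle of $G$. An isometric path $P$ is avoidable in $G$ if every isometric extension of $P$ in $G$ is closable. *)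

theory Defs
  imports Main "HOL-Library.Extended_Nat" "HOL-Library.Sublist"
begin

(* Edges have identities of their own, so parallel edges are different edges with equal end sets;
   a loop is an edge whose end set is a singleton. *)
record ('v, 'e) multigraph =
  verts :: "'v set"
  edges :: "'e set"
  ends :: "'e \<Rightarrow> 'v set"

definition wf_graph :: "('v, 'e) multigraph \<Rightarrow> bool" where
  "wf_graph G \<longleftrightarrow>
     (\<forall>e\<in>edges G. ends G e \<subseteq> verts G \<and> (card (ends G e) = 1 \<or> card (ends G e) = 2))"

definition finite_graph :: "('v, 'e) multigraph \<Rightarrow> bool" where
  "finite_graph G \<longleftrightarrow> wf_graph G \<and> finite (verts G) \<and> finite (edges G)"

(* The path (v_1, e_1, v_2, ..., e_(k-1), v_k), k \<ge> 1, is given by its list of vertices and its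
   list of edges; its length is the length of the edge list. *)
definition is_path :: "('v, 'e) multigraph \<Rightarrow> 'v list \<Rightarrow> 'e list \<Rightarrow> bool" where
  "is_path G vs es \<longleftrightarrow>
     length vs = Suc (length es) \<and> distinct vs \<and> set vs \<subseteq> verts G \<and> set es \<subseteq> edges G \<and>
     (\<forall>i<length es. ends G (es ! i) = {vs ! i, vs ! Suc i})"

(* The infimum of the empty set is \<infinity>. *)
definition gdist :: "('v, 'e) multigraph \<Rightarrow> 'v \<Rightarrow> 'v \<Rightarrow> enat" where
  "gdist G u v = Inf {enat (length es) | vs es. is_path G vs es \<and> hd vs = u \<and> last vs = v}"

definition subgraph :: "('v, 'e) multigraph \<Rightarrow> ('v, 'e) multigraph \<Rightarrow> bool" where
  "subgraph H G \<longleftrightarrow>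
     wf_graph H \<and> verts H \<subseteq> verts G \<and> edges H \<subseteq> edges G \<and> (\<forall>e\<in>edges H. ends H e = ends G e)"

definition isometric :: "('v, 'e) multigraph \<Rightarrow> ('v, 'e) multigraph \<Rightarrow> bool" where
  "isometric H G \<longleftrightarrow>
     subgraph H G \<and> (\<forall>u\<in>verts H. \<forall>v\<in>verts H. gdist H u v = gdist G u v)"

definition subgraph_of :: "('v, 'e) multigraph \<Rightarrow> 'v list \<Rightarrow> 'e list \<Rightarrow> ('v, 'e) multigraph" where
  "subgraph_of G vs es = \<lparr>verts = set vs, edges = set es, ends = ends G\<rparr>"

definition isometric_path :: "('v, 'e) multigraph \<Rightarrow> 'v list \<Rightarrow> 'e list \<Rightarrow> bool" where
  "isometric_path G vs es \<longleftrightarrow> is_path G vs es \<and> isometric (subgraph_of G vs es) G"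

(* The i-th edge joins the i-th vertex to its cyclic successor. A loop is a cycle of length 1, and
   two parallel edges form a cycle of length 2; distinctness of the edges only matters there. *)
definition is_cycle :: "('v, 'e) multigraph \<Rightarrow> 'v list \<Rightarrow> 'e list \<Rightarrow> bool" where
  "is_cycle G cs fs \<longleftrightarrow>
     cs \<noteq> [] \<and> length cs = length fs \<and> distinct cs \<and> distinct fs \<and>
     set cs \<subseteq> verts G \<and> set fs \<subseteq> edges G \<and>
     (\<forall>i<length fs. ends G (fs ! i) = {cs ! i, cs ! (Suc i mod length cs)})"

definition isometric_cycle :: "('v, 'e) multigraph \<Rightarrow> 'v list \<Rightarrow> 'e list \<Rightarrow> bool" where
  "isometric_cycle G cs fs \<longleftrightarrow> is_cycle G cs fs \<and> isometric (subgraph_of G cs fs) G"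

(* Following the cycle from a suitable starting point traverses the path, in one of its two
   directions. *)
definition contiguous_in_cycle ::
  "'v list \<Rightarrow> 'e list \<Rightarrow> 'v list \<Rightarrow> 'e list \<Rightarrow> bool" where
  "contiguous_in_cycle vs es cs fs \<longleftrightarrow>
     (\<exists>m. prefix vs (rotate m cs) \<and> prefix es (rotate m fs)) \<or>
     (\<exists>m. prefix (rev vs) (rotate m cs) \<and> prefix (rev es) (rotate m fs))"

definition closable :: "('v, 'e) multigraph \<Rightarrow> 'v list \<Rightarrow> 'e list \<Rightarrow> bool" where
  "closable G vs es \<longleftrightarrow>
     isometric_path G vs es \<and>
     (\<exists>cs fs. isometric_cycle G cs fs \<and> contiguous_in_cycle vs es cs fs)"

definition isometric_extension ::
  "('v, 'e) multigraph \<Rightarrow> 'v list \<Rightarrow> 'e list \<Rightarrow> 'v list \<Rightarrow> 'e list \<Rightarrow> bool" where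
  "isometric_extension G vs es vs' es' \<longleftrightarrow>
     isometric_path G vs' es' \<and> (\<exists>u v e f. vs' = u # vs @ [v] \<and> es' = e # es @ [f])"

definition avoidable :: "('v, 'e) multigraph \<Rightarrow> 'v list \<Rightarrow> 'e list \<Rightarrow> bool" where
  "avoidable G vs es \<longleftrightarrow>
     isometric_path G vs es \<and>
     (\<forall>vs' es'. isometric_extension G vs es vs' es' \<longrightarrow> closable G vs' es')"

end

theory Submission
  imports Defs "HOL-Library.Nat_Bijection"
begin

text \<open>
  The graph is the Cartesian product of the cube of dimension \<open>l\<close> with the wheel \<open>W\<close> that
  consists of a hub joined to all vertices of a rim of length 6. Distances add up over the two
  factors, the wheel has diameter 2, and so the product has diameter \<open>D = l + 2\<close>.

  Two facts about it suffice. First, every pair of vertices at distance \<open>l\<close> can be moved apart, one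
  step at each end, to a pair at distance \<open>D\<close> (\<open>product_dist_widen\<close>): the pair falls short of the
  diameter by 2 in total, and each missing unit can be gained either by flipping a coordinate of the
  cube in which the two vertices agree or by a step in the wheel. So every isometric path of length
  \<open>l\<close> has an isometric extension whose ends are at distance \<open>D\<close>.

  Second, no isometric cycle contains two vertices at distance \<open>D\<close> (\<open>isometric_cycle_diameter\<close>), so
  this extension is not closable. An isometric cycle that did contain them would have length \<open>2 * D\<close>
  or \<open>2 * D + 1\<close>, since a shorter one has smaller diameter and a longer one has vertices
  at distance more than \<open>D\<close>. Any \<open>D\<close> consecutive steps on it form a geodesic
  of maximal length, whose projection to the wheel is therefore a geodesic of length 2, with pauses.
  Hence the hub, whose eccentricity in \<open>W\<close> is 1, never occurs, and the projection keeps going around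
  the rim in one direction: after \<open>2 * D\<close> steps it has moved four times, from rim vertex \<open>a\<close> to
  \<open>a + 4\<close>, at distance 2 from \<open>a\<close>. But \<open>2 * D\<close> steps lead to the starting vertex of the cycle or
  to a neighbour of it.
\<close>

section \<open>Distances from potentials\<close>

text \<open>
  A potential for \<open>v\<close> changes by at most 1 along each edge, so no path to \<open>v\<close> is shorter than it
  predicts, and it can be decreased at each vertex other than \<open>v\<close>, so following the descent gives
  a path of exactly the predicted length. It therefore certifies distances to \<open>v\<close> without any
  surgery on paths.
\<close>

definition distance_potential :: "('v, 'e) multigraph \<Rightarrow> 'v \<Rightarrow> ('v \<Rightarrow> nat) \<Rightarrow> bool" where
  "distance_potential G v f \<longleftrightarrow> f v = 0 \<and>
     (\<forall>e\<in>edges G. \<forall>a b. ends G e = {a, b} \<longrightarrow> f a \<le> Suc (f b)) \<and>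
     (\<forall>a\<in>verts G. a \<noteq> v \<longrightarrow>
        (\<exists>e\<in>edges G. \<exists>b\<in>verts G. ends G e = {a, b} \<and> f a = Suc (f b)))"

lemma potential_le_along_path:
  assumes "is_path G vs es" "distance_potential G v f"
    and "i \<le> j" "j \<le> length es"
  shows "f (vs ! i) \<le> f (vs ! j) + (j - i)"
  using assms(3,4)
proof (induction j rule: dec_induct)
  case base
  then show ?case by simp
next
  case (step k)
  have "es ! k \<in> edges G" "ends G (es ! k) = {vs ! k, vs ! Suc k}"
    using assms(1) step unfolding is_path_def by (auto simp: subset_iff)
  then have "f (vs ! k) \<le> Suc (f (vs ! Suc k))" 
    using assms(2) unfolding distance_potential_def by blast
  with step show ?case by auto
qed

lemma is_path_Cons:
  assumes "is_path G vs es" "e \<in> edges G" "ends G e = {u, hd vs}" "u \<in> verts G" "u \<notin> set vs"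
  shows "is_path G (u # vs) (e # es)"
proof -
  from assms(1) have "vs \<noteq> []" unfolding is_path_def by auto
  with assms show ?thesis
    unfolding is_path_def by (auto simp: nth_Cons hd_conv_nth split: nat.split)
qed

lemma is_path_snoc:
  assumes "is_path G vs es" "e \<in> edges G" "ends G e = {last vs, v}" "v \<in> verts G" "v \<notin> set vs"
  shows "is_path G (vs @ [v]) (es @ [e])"
proof -
  from assms(1) have len: "length vs = Suc (length es)" unfolding is_path_def by auto
  then have "last vs = vs ! length es" by (metis diff_Suc_1 last_conv_nth length_0_conv nat.distinct(1))
  with assms len show ?thesis
    unfolding is_path_def by (auto simp: nth_append less_Suc_eq)
qed

lemma descending_path_exists:
  assumes "u \<in> verts G" and pot: "distance_potential G v f"
  shows "\<exists>vs es. is_path G vs es \<and> hd vs = u \<and> last vs = v \<and> length es = f u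
           \<and> (\<forall>x\<in>set vs. f x \<le> f u)"
  \<comment> \<open>The bound on \<open>f\<close> makes the induction work: it keeps the new first vertex off the path.\<close>
  using assms(1)
proof (induction "f u" arbitrary: u)
  case 0
  then have "u = v" using pot unfolding distance_potential_def by auto
  with 0 show ?case
    by (intro exI[of _ "[u]"] exI[of _ "[]"]) (auto simp: is_path_def)
next
  case (Suc k)
  then have "u \<noteq> v" using pot by (auto simp: distance_potential_def)
  then obtain e b where e: "e \<in> edges G" "b \<in> verts G" "ends G e = {u, b}" "f u = Suc (f b)"
    using pot Suc.prems unfolding distance_potential_def by blast
  then have "k = f b" using Suc.hyps(2) by simp
  from Suc.hyps(1)[OF this e(2)]
  obtain vs es where p: "is_path G vs es" "hd vs = b" "last vs = v" "length es = f b"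
    "\<forall>x\<in>set vs. f x \<le> f b" by blast
  have "u \<notin> set vs" using p(5) e(4) by auto
  then have "is_path G (u # vs) (e # es)" using is_path_Cons[OF p(1) e(1)] p(2) e(3) Suc.prems by simp
  moreover have "vs \<noteq> []" using p(1) by (auto simp: is_path_def)
  ultimately show ?case using p e
    by (intro exI[of _ "u # vs"] exI[of _ "e # es"]) auto
qed

lemma gdist_eq_potential:
  assumes "u \<in> verts G" and pot: "distance_potential G v f"
  shows "gdist G u v = enat (f u)"
proof -
  let ?L = "{enat (length es) | vs es. is_path G vs es \<and> hd vs = u \<and> last vs = v}"
  obtain vs es where "is_path G vs es" "hd vs = u" "last vs = v" "length es = f u"
    using descending_path_exists[OF assms] by blast
  then have mem: "enat (f u) \<in> ?L" by force
  have "enat (f u) \<le> x" if "x \<in> ?L" for x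
  proof -
    from that obtain vs es where p: "x = enat (length es)" "is_path G vs es" "hd vs = u" "last vs = v"
      by auto
    have "vs \<noteq> []" "length vs = Suc (length es)" using p(2) by (auto simp: is_path_def)
    then have "vs ! 0 = u" "vs ! length es = v" using p by (auto simp: hd_conv_nth last_conv_nth)
    with potential_le_along_path[OF p(2) pot, of 0 "length es"] p(1) pot show ?thesis
      by (simp add: distance_potential_def)
  qed
  then show ?thesis unfolding gdist_def using mem by (intro antisym Inf_lower Inf_greatest) auto
qed

text \<open>
  In a path or a cycle the vertices are the entries of a list, and distances are functions of the
  positions. This form takes the potential as a function of the position.
\<close>

lemma gdist_eq_index_potential:
  assumes "distinct vs" "verts H = set vs" "i < length vs" "j < length vs" "g j = 0"
    and lip: "\<And>e. e \<in> edges H \<Longrightarrow> \<exists>a<length vs. \<exists>b<length vs.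
                ends H e = {vs ! a, vs ! b} \<and> g a \<le> Suc (g b) \<and> g b \<le> Suc (g a)"
    and desc: "\<And>a. a < length vs \<Longrightarrow> a \<noteq> j \<Longrightarrow>
                 \<exists>e\<in>edges H. \<exists>b<length vs. ends H e = {vs ! a, vs ! b} \<and> g a = Suc (g b)"
  shows "gdist H (vs ! i) (vs ! j) = enat (g i)"
proof -
  define f where "f x = g (inv_into {..<length vs} ((!) vs) x)" for x
  have f: "f (vs ! a) = g a" if "a < length vs" for a
    unfolding f_def using that assms(1) by (simp add: inv_into_f_f inj_on_nth)
  have "gdist H (vs ! i) (vs ! j) = enat (f (vs ! i))"
  proof (rule gdist_eq_potential)
    have "f x \<le> Suc (f y)" if "e \<in> edges H" "ends H e = {x, y}" for e x y
      using lip[of e] f that by (auto simp: doubleton_eq_iff)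
    moreover have "\<exists>e\<in>edges H. \<exists>b\<in>verts H. ends H e = {a, b} \<and> f a = Suc (f b)"
      if "a \<in> verts H" "a \<noteq> vs ! j" for a
    proof -
      from that obtain k where k: "k < length vs" "a = vs ! k" "k \<noteq> j"
        using assms(2) by (auto simp: in_set_conv_nth)
      with desc[of k] obtain e b where
        "e \<in> edges H" "b < length vs" "ends H e = {a, vs ! b}" "g k = Suc (g b)"
        by blast
      with f k assms(2) show ?thesis
        by (intro bexI[of _ e] bexI[of _ "vs ! b"]) auto
    qed
    ultimately show "distance_potential H (vs ! j) f"
      using assms f by (auto simp: distance_potential_def)
  qed (use assms in auto)
  with f assms show ?thesis by simp
qed

lemma gdist_in_path:
  assumes "is_path G vs es" "i \<le> length es" "j \<le> length es"
  shows "gdist (subgraph_of G vs es) (vs ! i) (vs ! j) = enat ((i - j) + (j - i))"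
proof (rule gdist_eq_index_potential[where g = "\<lambda>a. (a - j) + (j - a)"])
  show "distinct vs" "verts (subgraph_of G vs es) = set vs" "i < length vs" "j < length vs"
    using assms by (auto simp: is_path_def subgraph_of_def)
  show "(j - j) + (j - j) = 0" by simp
  fix e assume "e \<in> edges (subgraph_of G vs es)"
  then obtain k where "k < length es" "e = es ! k"
    by (auto simp: subgraph_of_def in_set_conv_nth)
  then show "\<exists>a<length vs. \<exists>b<length vs. ends (subgraph_of G vs es) e = {vs ! a, vs ! b} \<and>
      (a - j) + (j - a) \<le> Suc ((b - j) + (j - b)) \<and> (b - j) + (j - b) \<le> Suc ((a - j) + (j - a))"
    using assms by (intro exI[of _ k] exI[of _ "Suc k"] conjI) (auto simp: is_path_def subgraph_of_def)
next
  fix a assume a: "a < length vs" "a \<noteq> j"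
  have len: "length vs = Suc (length es)" using assms by (auto simp: is_path_def)
  show "\<exists>e\<in>edges (subgraph_of G vs es). \<exists>b<length vs.
      ends (subgraph_of G vs es) e = {vs ! a, vs ! b} \<and> (a - j) + (j - a) = Suc ((b - j) + (j - b))"
  proof (cases "a < j")
    case True
    then show ?thesis using assms len
      by (intro bexI[of _ "es ! a"] exI[of _ "Suc a"]) (auto simp: is_path_def subgraph_of_def)
  next
    case False
    then show ?thesis using assms len a
      by (intro bexI[of _ "es ! (a - 1)"] exI[of _ "a - 1"])
        (auto simp: is_path_def subgraph_of_def insert_commute)
  qed
qed

text \<open>
  With \<open>r\<close> the number of steps from \<open>j\<close> forward to \<open>i\<close> around a cycle of length \<open>n\<close>, the way back
  takes \<open>n - r\<close> steps. The positions need not be reduced modulo \<open>n\<close>.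
\<close>

definition cyc_dist :: "nat \<Rightarrow> nat \<Rightarrow> nat \<Rightarrow> nat" where
  "cyc_dist n i j = (let r = nat ((int i - int j) mod int n) in min r (n - r))"

lemma cyc_dist_mod:
  "cyc_dist n (i mod n) j = cyc_dist n i j"
  "cyc_dist n i (j mod n) = cyc_dist n i j"
  by (simp_all add: cyc_dist_def zmod_int mod_simps)

lemma residue_Suc:
  fixes i j n :: nat
  assumes "n > 0"
  shows "nat ((int (Suc i) - int j) mod int n) =
    (if Suc (nat ((int i - int j) mod int n)) = n then 0 else Suc (nat ((int i - int j) mod int n)))"
proof -
  define r where "r = (int i - int j) mod int n"
  have r: "0 \<le> r" "r < int n" using assms by (auto simp: r_def)
  have "(int (Suc i) - int j) mod int n = (r + 1) mod int n"
    unfolding r_def by (simp add: mod_simps algebra_simps)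
  moreover have "(r + 1) mod int n = (if r + 1 = int n then 0 else r + 1)" using r by auto
  ultimately show ?thesis using r unfolding r_def[symmetric] by (auto simp: nat_add_distrib)
qed

lemma cyc_dist_Suc:
  assumes "n > 0"
  shows "cyc_dist n (Suc i) j \<le> Suc (cyc_dist n i j)" "cyc_dist n i j \<le> Suc (cyc_dist n (Suc i) j)"
    "n \<le> 2 * nat ((int i - int j) mod int n) \<Longrightarrow> cyc_dist n i j = Suc (cyc_dist n (Suc i) j)"
    "0 < nat ((int (Suc i) - int j) mod int n) \<Longrightarrow> 2 * nat ((int (Suc i) - int j) mod int n) \<le> n \<Longrightarrow>
       cyc_dist n (Suc i) j = Suc (cyc_dist n i j)"
proof -
  define r where "r = nat ((int i - int j) mod int n)"
  define s where "s = nat ((int (Suc i) - int j) mod int n)"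
  have s: "s = (if Suc r = n then 0 else Suc r)" unfolding r_def s_def by (rule residue_Suc[OF assms])
  have r: "r < n" using assms by (simp add: r_def nat_less_iff)
  have c: "cyc_dist n i j = min r (n - r)" "cyc_dist n (Suc i) j = min s (n - s)"
    by (simp_all only: cyc_dist_def Let_def r_def s_def)
  show "cyc_dist n (Suc i) j \<le> Suc (cyc_dist n i j)" "cyc_dist n i j \<le> Suc (cyc_dist n (Suc i) j)"
    unfolding c s using r by auto
  show "cyc_dist n i j = Suc (cyc_dist n (Suc i) j)" if "n \<le> 2 * nat ((int i - int j) mod int n)"
    using that r unfolding r_def[symmetric] c s by auto
  show "cyc_dist n (Suc i) j = Suc (cyc_dist n i j)"
    if "0 < nat ((int (Suc i) - int j) mod int n)" "2 * nat ((int (Suc i) - int j) mod int n) \<le> n"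
    using that r s unfolding s_def[symmetric] c by (auto split: if_splits)
qed

lemma gdist_in_cycle:
  assumes cyc: "is_cycle G cs fs" and ij: "i < length cs" "j < length cs"
  shows "gdist (subgraph_of G cs fs) (cs ! i) (cs ! j) = enat (cyc_dist (length cs) i j)"
proof (rule gdist_eq_index_potential[where g = "\<lambda>a. cyc_dist (length cs) a j"])
  let ?n = "length cs" and ?H = "subgraph_of G cs fs"
  have n: "?n > 0" "length fs = ?n" using cyc by (auto simp: is_cycle_def)
  have edge: "fs ! k \<in> edges ?H" "ends ?H (fs ! k) = {cs ! k, cs ! (Suc k mod ?n)}" if "k < ?n" for k
    using cyc that by (auto simp: is_cycle_def subgraph_of_def)
  show "distinct cs" "verts ?H = set cs" "i < ?n" "j < ?n"
    using assms by (auto simp: is_cycle_def subgraph_of_def)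
  show "cyc_dist ?n j j = 0" by (simp add: cyc_dist_def)
  {
    fix e assume "e \<in> edges ?H"
    then obtain k where "k < ?n" "e = fs ! k"
      using n by (auto simp: subgraph_of_def in_set_conv_nth)
    then show "\<exists>a<?n. \<exists>b<?n. ends ?H e = {cs ! a, cs ! b} \<and>
        cyc_dist ?n a j \<le> Suc (cyc_dist ?n b j) \<and> cyc_dist ?n b j \<le> Suc (cyc_dist ?n a j)"
      using edge cyc_dist_Suc(1,2)[OF n(1), of k j] n
      by (intro exI[of _ k] exI[of _ "Suc k mod ?n"]) (auto simp: cyc_dist_mod)
  }
  fix a assume a: "a < ?n" "a \<noteq> j"
  have ne: "0 < nat ((int a - int j) mod int ?n)"
  proof -
    have "(int a - int j) mod int ?n \<noteq> 0"
    proof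
      assume "(int a - int j) mod int ?n = 0"
      then have "int a mod int ?n = int j mod int ?n" by (simp add: mod_eq_dvd_iff dvd_eq_mod_eq_0)
      with a ij show False by simp
    qed
    then show ?thesis
      unfolding zero_less_nat_eq using n(1) pos_mod_sign[of "int ?n" "int a - int j"] by linarith
  qed
  show "\<exists>e\<in>edges ?H. \<exists>b<?n. ends ?H e = {cs ! a, cs ! b} \<and> cyc_dist ?n a j = Suc (cyc_dist ?n b j)"
  proof (cases "?n \<le> 2 * nat ((int a - int j) mod int ?n)")
    case True
    with edge[OF a(1)] cyc_dist_Suc(3)[OF n(1), of a j] n show ?thesis
      by (intro bexI[of _ "fs ! a"] exI[of _ "Suc a mod ?n"]) (auto simp: cyc_dist_mod)
  next
    case False
    define b where "b = (a + ?n - 1) mod ?n"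
    have b: "b < ?n" "Suc b mod ?n = a"
      using n a unfolding b_def by (auto simp: mod_Suc_eq)
    have I: "(int (Suc b) - int j) mod int ?n = (int a - int j) mod int ?n"
      by (subst b(2)[symmetric], simp only: zmod_int mod_simps)
    have "cyc_dist ?n (Suc b) j = Suc (cyc_dist ?n b j)"
      using False ne cyc_dist_Suc(4)[OF n(1), of b j] unfolding I by linarith
    then have "cyc_dist ?n a j = Suc (cyc_dist ?n b j)" using cyc_dist_mod(1)[of ?n "Suc b" j] b by simp
    with edge[OF b(1)] b show ?thesis
      by (intro bexI[of _ "fs ! b"] exI[of _ b]) (auto simp: insert_commute)
  qed
qed

lemma cyc_dist_le_half: "2 * cyc_dist n i j \<le> n"
  by (auto simp: cyc_dist_def Let_def)

lemma cyc_dist_add: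
  assumes "d \<le> n" "n > 0"
  shows "cyc_dist n (i + d) i = min d (n - d)"
  using assms by (cases "d = n") (simp_all add: cyc_dist_def)

section \<open>Graphs of integral metrics\<close>

text \<open>
  An integer-valued metric is the distance of its graph of unit pairs as soon as from each point
  one can make a unit step towards any other point. Vertices and edges of the graph are natural
  numbers, an edge being the code of its end set.
\<close>

locale geodesic_metric =
  fixes V :: "nat set" and d :: "nat \<Rightarrow> nat \<Rightarrow> nat"
  assumes fin: "finite V"
    and zero_iff: "\<And>u v. u \<in> V \<Longrightarrow> v \<in> V \<Longrightarrow> d u v = 0 \<longleftrightarrow> u = v"
    and sym: "\<And>u v. d u v = d v u"
    and triangle: "\<And>u v w. u \<in> V \<Longrightarrow> v \<in> V \<Longrightarrow> w \<in> V \<Longrightarrow> d u w \<le> d u v + d v w"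
    and step: "\<And>u v. u \<in> V \<Longrightarrow> v \<in> V \<Longrightarrow> u \<noteq> v \<Longrightarrow> \<exists>w\<in>V. d u w = 1 \<and> d u v = Suc (d w v)"
begin

definition unit_graph :: "(nat, nat) multigraph" where
  "unit_graph = \<lparr>verts = V, edges = {set_encode {u, v} | u v. u \<in> V \<and> v \<in> V \<and> d u v = 1}, ends = set_decode\<rparr>"

lemma verts_unit_graph [simp]: "verts unit_graph = V"
  by (simp add: unit_graph_def)

lemma unit_graph_edge: "u \<in> V \<Longrightarrow> v \<in> V \<Longrightarrow> d u v = 1 \<Longrightarrow> \<exists>e\<in>edges unit_graph. ends unit_graph e = {u, v}"
  by (force simp: unit_graph_def)

lemma unit_graph_edgeD: "e \<in> edges unit_graph \<Longrightarrow> ends unit_graph e = {a, b} \<Longrightarrow> a \<in> V \<and> b \<in> V \<and> d a b = 1"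
  by (auto simp: unit_graph_def doubleton_eq_iff sym)

lemma finite_unit_graph: "finite_graph unit_graph"
proof -
  have "edges unit_graph \<subseteq> (\<lambda>(u, v). set_encode {u, v}) ` (V \<times> V)" by (auto simp: unit_graph_def)
  then have "finite (edges unit_graph)" using fin finite_subset by blast
  moreover have "wf_graph unit_graph"
  proof -
    have "ends unit_graph e \<subseteq> V \<and> (card (ends unit_graph e) = 1 \<or> card (ends unit_graph e) = 2)" if "e \<in> edges unit_graph" for e
    proof -
      from that obtain u v where "u \<in> V" "v \<in> V" "ends unit_graph e = {u, v}" by (auto simp: unit_graph_def)
      then show ?thesis by (cases "u = v") auto
    qed
    then show ?thesis by (simp add: wf_graph_def)
  qed
  ultimately show ?thesis using fin by (simp add: finite_graph_def)
qed

lemma distance_potential_unit_graph: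
  assumes "v \<in> V"
  shows "distance_potential unit_graph v (\<lambda>u. d u v)"
proof -
  have "d a v \<le> Suc (d b v)" if "e \<in> edges unit_graph" "ends unit_graph e = {a, b}" for e a b
    using unit_graph_edgeD[OF that] triangle[of a b v] assms by simp
  moreover have "\<exists>e\<in>edges unit_graph. \<exists>b\<in>V. ends unit_graph e = {a, b} \<and> d a v = Suc (d b v)"
    if a: "a \<in> V" "a \<noteq> v" for a
  proof -
    obtain w where w: "w \<in> V" "d a w = 1" "d a v = Suc (d w v)" using step[OF a(1) assms a(2)] by blast
    with unit_graph_edge[OF a(1) w(1,2)] show ?thesis by blast
  qed
  ultimately show ?thesis using assms zero_iff by (auto simp: distance_potential_def)
qed

lemma gdist_unit_graph:
  assumes "u \<in> V" "v \<in> V"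
  shows "gdist unit_graph u v = enat (d u v)"
  using gdist_eq_potential[OF _ distance_potential_unit_graph] assms by simp

text \<open>
  Only the distance of the two ends matters: if a vertex pair on the path were closer in the graph
  than along the path, then by the triangle inequality so would be the two ends.
\<close>

lemma isometric_path_iff_endpoints:
  assumes p: "is_path unit_graph vs es"
  shows "isometric_path unit_graph vs es \<longleftrightarrow> d (hd vs) (last vs) = length es"
proof -
  have len: "length vs = Suc (length es)" "set vs \<subseteq> V" "vs \<noteq> []" using p by (auto simp: is_path_def)
  then have ends: "hd vs = vs ! 0" "last vs = vs ! length es" by (auto simp: hd_conv_nth last_conv_nth)
  have V: "vs ! i \<in> V" if "i \<le> length es" for i using that len by auto
  show ?thesis
  proof
    assume "isometric_path unit_graph vs es"
    then have "gdist (subgraph_of unit_graph vs es) (hd vs) (last vs) = gdist unit_graph (hd vs) (last vs)"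
      using len by (simp add: isometric_path_def isometric_def subgraph_of_def)
    then show "d (hd vs) (last vs) = length es"
      using gdist_in_path[OF p, of 0 "length es"] gdist_unit_graph[of "hd vs" "last vs"] V ends by simp
  next
    assume D: "d (hd vs) (last vs) = length es"
    have up: "d (vs ! i) (vs ! j) \<le> j - i" if "i \<le> j" "j \<le> length es" for i j
      using potential_le_along_path[OF p distance_potential_unit_graph[OF V[of j]], of i j] zero_iff[OF V[of j] V[of j]] that by simp
    have eq: "d (vs ! i) (vs ! j) = j - i" if "i \<le> j" "j \<le> length es" for i j
    proof -
      have "length es \<le> d (vs ! 0) (vs ! i) + d (vs ! i) (vs ! j) + d (vs ! j) (vs ! length es)"
        using triangle[of "vs ! 0" "vs ! i" "vs ! length es"] triangle[of "vs ! i" "vs ! j" "vs ! length es"]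
          V that D ends by simp
      with up[of 0 i] up[of i j] up[of j "length es"] that show ?thesis by simp
    qed
    have "subgraph (subgraph_of unit_graph vs es) unit_graph"
    proof -
      have "ends unit_graph e \<subseteq> set vs" if "e \<in> set es" for e
      proof -
        from that obtain k where "k < length es" "e = es ! k" by (auto simp: in_set_conv_nth)
        then have "ends unit_graph e = {vs ! k, vs ! Suc k}" using p by (simp add: is_path_def)
        with \<open>k < length es\<close> len show ?thesis by simp
      qed
      then show ?thesis using p finite_unit_graph
        by (auto simp: subgraph_def subgraph_of_def is_path_def finite_graph_def wf_graph_def)
    qed
    moreover have "gdist (subgraph_of unit_graph vs es) u v = gdist unit_graph u v"
      if "u \<in> verts (subgraph_of unit_graph vs es)" "v \<in> verts (subgraph_of unit_graph vs es)" for u v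
    proof -
      from that obtain i j where ij: "i \<le> length es" "j \<le> length es" "u = vs ! i" "v = vs ! j"
        using len by (auto simp: subgraph_of_def in_set_conv_nth less_Suc_eq_le)
      then show ?thesis using eq[of i j] eq[of j i] sym[of u v] gdist_in_path[OF p, of i j] gdist_unit_graph[of u v] V
        by (cases "i \<le> j") auto
    qed
    ultimately show "isometric_path unit_graph vs es" using p by (simp add: isometric_path_def isometric_def)
  qed
qed

lemma isometric_path_exists:
  assumes "u \<in> V" "v \<in> V"
  shows "\<exists>vs es. isometric_path unit_graph vs es \<and> length es = d u v"
proof -
  obtain vs es where "is_path unit_graph vs es" "hd vs = u" "last vs = v" "length es = d u v"
    using descending_path_exists[OF _ distance_potential_unit_graph, of u v] assms by auto
  then show ?thesis using isometric_path_iff_endpoints by metis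
qed

text \<open>
  The new ends avoid the old path because they are further from each other than from any vertex
  of the old path.
\<close>

lemma isometric_extension_exists:
  assumes iso: "isometric_path unit_graph vs es"
    and u: "u \<in> V" "d u (hd vs) = 1" and v: "v \<in> V" "d (last vs) v = 1"
    and uv: "d u v = length es + 2"
  shows "\<exists>e f. isometric_extension unit_graph vs es (u # vs @ [v]) (e # es @ [f])"
proof -
  have p: "is_path unit_graph vs es" using iso by (simp add: isometric_path_def)
  then have len: "length vs = Suc (length es)" "set vs \<subseteq> V" "vs \<noteq> []" by (auto simp: is_path_def)
  then have ends: "hd vs = vs ! 0" "last vs = vs ! length es" by (auto simp: hd_conv_nth last_conv_nth)
  have V: "vs ! i \<in> V" if "i \<le> length es" for i using that len by auto
  have near: "d (vs ! i) v \<le> length es + 1" "d u (vs ! i) \<le> length es + 1" if i: "i \<le> length es" for i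
  proof -
    show "d (vs ! i) v \<le> length es + 1"
      using potential_le_along_path[OF p distance_potential_unit_graph[OF v(1)], of i "length es"] v(2) ends i by simp
    have "d (vs ! 0) (vs ! i) \<le> i"
      using potential_le_along_path[OF p distance_potential_unit_graph[OF V[OF i]], of 0 i] zero_iff[OF V[OF i] V[OF i]] i by simp
    then show "d u (vs ! i) \<le> length es + 1"
      using triangle[of u "vs ! 0" "vs ! i"] V[of 0] V[OF i] u ends i by simp
  qed
  have fresh: "u \<notin> set vs" "v \<notin> set vs" "u \<noteq> v"
    using near uv len zero_iff[OF v(1) v(1)] by (fastforce simp: in_set_conv_nth less_Suc_eq_le)+
  obtain f where f: "f \<in> edges unit_graph" "ends unit_graph f = {last vs, v}"
    using unit_graph_edge[of "last vs" v] v V ends by auto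
  obtain e where e: "e \<in> edges unit_graph" "ends unit_graph e = {u, hd vs}"
    using unit_graph_edge[of u "hd vs"] u V ends by auto
  have "is_path unit_graph (vs @ [v]) (es @ [f])" using is_path_snoc[OF p f] v(1) fresh by simp
  then have "is_path unit_graph (u # vs @ [v]) (e # es @ [f])"
    using is_path_Cons[of unit_graph "vs @ [v]" "es @ [f]" e u] e u(1) fresh len by simp
  then have "isometric_path unit_graph (u # vs @ [v]) (e # es @ [f])"
    using isometric_path_iff_endpoints uv by simp
  then show ?thesis unfolding isometric_extension_def by blast
qed

lemma isometric_cycle_dist:
  assumes "isometric_cycle unit_graph cs fs" "i < length cs" "j < length cs"
  shows "d (cs ! i) (cs ! j) = cyc_dist (length cs) i j"
proof -
  have c: "is_cycle unit_graph cs fs" using assms by (simp add: isometric_cycle_def)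
  have "gdist (subgraph_of unit_graph cs fs) (cs ! i) (cs ! j) = gdist unit_graph (cs ! i) (cs ! j)"
    using assms by (simp add: isometric_cycle_def isometric_def subgraph_of_def)
  moreover have "cs ! i \<in> V" "cs ! j \<in> V" using c assms by (auto simp: is_cycle_def)
  ultimately show ?thesis using gdist_in_cycle[OF c assms(2,3)] gdist_unit_graph by simp
qed

text \<open>
  All that is needed of an isometric cycle closing a path is that it contains the two ends,
  whose distance is the length of the path.
\<close>

lemma closable_endpoints:
  assumes "closable unit_graph vs es"
  shows "\<exists>cs fs i j. isometric_cycle unit_graph cs fs \<and> i < length cs \<and> j < length cs
           \<and> length es = d (cs ! i) (cs ! j)"
proof -
  from assms obtain cs fs where c: "isometric_cycle unit_graph cs fs" "contiguous_in_cycle vs es cs fs"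
    and iso: "isometric_path unit_graph vs es"
    by (auto simp: closable_def)
  then have "set vs \<subseteq> set cs" by (auto simp: contiguous_in_cycle_def dest!: set_mono_prefix)
  moreover have "vs \<noteq> []" using iso by (auto simp: isometric_path_def is_path_def)
  ultimately have "hd vs \<in> set cs" "last vs \<in> set cs" by auto
  then obtain i j where "i < length cs" "hd vs = cs ! i" "j < length cs" "last vs = cs ! j"
    by (auto simp: in_set_conv_nth)
  moreover have "d (hd vs) (last vs) = length es"
    using iso isometric_path_iff_endpoints by (auto simp: isometric_path_def)
  ultimately show ?thesis using c by metis
qed

end

section \<open>The wheel with six spokes\<close>

text \<open>
  The rim vertices are \<open>0, \<dots>, 5\<close> in cyclic order, and 6 is the hub.
\<close>

definition wheel_dist :: "nat \<Rightarrow> nat \<Rightarrow> nat" where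
  "wheel_dist i j =
     (if i = j then 0
      else if i = 6 \<or> j = 6 \<or> j = (i + 1) mod 6 \<or> i = (j + 1) mod 6 then 1 else 2)"

lemma wheel_dist_sym: "wheel_dist i j = wheel_dist j i"
  by (auto simp: wheel_dist_def)

lemma wheel_dist_self [simp]: "wheel_dist i i = 0"
  by (simp add: wheel_dist_def)

lemma wheel_dist_zero_iff [simp]: "wheel_dist i j = 0 \<longleftrightarrow> i = j"
  by (auto simp: wheel_dist_def)

lemma wheel_dist_le: "wheel_dist i j \<le> 2"
  by (auto simp: wheel_dist_def)

lemma wheel_dist_triangle: "wheel_dist i k \<le> wheel_dist i j + wheel_dist j k"
proof (cases "i = j \<or> j = k")
  case True
  then show ?thesis by auto
next
  case False
  then have "wheel_dist i j \<noteq> 0" "wheel_dist j k \<noteq> 0" by auto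
  with wheel_dist_le[of i k] show ?thesis by linarith
qed

lemma wheel_dist_step:
  assumes "i \<noteq> j" "j < 7"
  shows "\<exists>k<7. wheel_dist i k = 1 \<and> wheel_dist i j = Suc (wheel_dist k j)"
proof (cases "wheel_dist i j = 1")
  case True
  with assms show ?thesis by (intro exI[of _ j]) auto
next
  case False
  with assms show ?thesis by (intro exI[of _ 6]) (auto simp: wheel_dist_def split: if_splits)
qed

lemma less_7_in_upt: "i < 7 \<Longrightarrow> i \<in> set [0..<7]" for i :: nat
  by simp

lemma wheel_dist_widen_vertex:
  assumes "i < 7"
  shows "\<exists>j<7. \<exists>k<7. wheel_dist j i = 1 \<and> wheel_dist i k = 1 \<and> wheel_dist j k = 2"
proof -
  have "\<forall>i\<in>set [0..<7]. \<exists>j\<in>set [0..<7]. wheel_dist j i = 1 \<and> (\<exists>k\<in>set [0..<7]. wheel_dist i k = 1 \<and> wheel_dist j k = 2)"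
    by code_simp
  with assms show ?thesis by fastforce
qed

lemma wheel_dist_widen_edge:
  assumes "i < 7" "j < 7" "wheel_dist i j = 1"
  shows "(\<exists>k<7. wheel_dist k i = 1 \<and> wheel_dist k j = 2) \<or> (\<exists>k<7. wheel_dist j k = 1 \<and> wheel_dist i k = 2)"
proof -
  have "\<forall>i\<in>set [0..<7]. \<forall>j\<in>set [0..<7]. wheel_dist i j = 1 \<longrightarrow> (\<exists>k\<in>set [0..<7]. wheel_dist k i = 1 \<and> wheel_dist k j = 2) \<or> (\<exists>k\<in>set [0..<7]. wheel_dist j k = 1 \<and> wheel_dist i k = 2)"
    by code_simp
  with assms show ?thesis by (metis less_7_in_upt atLeastLessThan_iff set_upt)
qed

text \<open>
  The distances 2 force all five vertices onto the rim and forbid the walk to turn back, so it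
  runs to \<open>a \<plusminus> 4\<close>. A rim of length 4 or 5 would bring it back to \<open>a\<close> or next to \<open>a\<close>; length 6 is
  the least for which it does not come back.
\<close>

lemma wheel_no_short_antipodal_walk:
  assumes "a < 7" "b < 7" "c < 7" "d < 7" "e < 7"
    and "wheel_dist a b = 1" "wheel_dist b c = 1" "wheel_dist c d = 1" "wheel_dist d e = 1"
    and "wheel_dist a c = 2" "wheel_dist b d = 2" "wheel_dist c e = 2"
  shows "wheel_dist a e = 2"
proof -
  have "\<forall>a\<in>set [0..<7]. \<forall>b\<in>set [0..<7]. wheel_dist a b = 1 \<longrightarrow>
         (\<forall>c\<in>set [0..<7]. wheel_dist b c = 1 \<longrightarrow> wheel_dist a c = 2 \<longrightarrow>
         (\<forall>d\<in>set [0..<7]. wheel_dist c d = 1 \<longrightarrow> wheel_dist b d = 2 \<longrightarrow>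
         (\<forall>e\<in>set [0..<7]. wheel_dist d e = 1 \<longrightarrow> wheel_dist c e = 2 \<longrightarrow> wheel_dist a e = 2)))"
    by code_simp
  with assms show ?thesis by (meson less_7_in_upt)
qed

section \<open>The product of a cube and the wheel\<close>

definition hamming :: "nat set \<Rightarrow> nat set \<Rightarrow> nat" where
  "hamming A B = card (sym_diff A B)"

lemma hamming_sym: "hamming A B = hamming B A"
  by (simp add: hamming_def Un_commute)

lemma hamming_zero_iff: "finite A \<Longrightarrow> finite B \<Longrightarrow> hamming A B = 0 \<longleftrightarrow> A = B"
  by (auto simp: hamming_def)

lemma hamming_triangle:
  assumes "finite A" "finite B" "finite C"
  shows "hamming A C \<le> hamming A B + hamming B C"
proof -
  have "hamming A C \<le> card (sym_diff A B \<union> sym_diff B C)"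
    unfolding hamming_def using assms by (intro card_mono) auto
  also have "\<dots> \<le> hamming A B + hamming B C"
    unfolding hamming_def by (rule card_Un_le)
  finally show ?thesis .
qed

lemma hamming_le: "A \<subseteq> {..<l} \<Longrightarrow> B \<subseteq> {..<l} \<Longrightarrow> hamming A B \<le> l"
  unfolding hamming_def using card_mono[of "{..<l}" "sym_diff A B"] by auto

lemma hamming_flip_self: "hamming A (sym_diff A {c}) = 1" "hamming (sym_diff A {c}) A = 1"
proof -
  have "sym_diff A (sym_diff A {c}) = {c}" by auto
  then show "hamming A (sym_diff A {c}) = 1" unfolding hamming_def by (metis card_1_singleton_iff One_nat_def)
  then show "hamming (sym_diff A {c}) A = 1" using hamming_sym by metis
qed

lemma hamming_flip:
  assumes "finite A" "finite B"
  shows "c \<notin> sym_diff A B \<Longrightarrow> hamming (sym_diff A {c}) B = Suc (hamming A B)"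
    and "c \<in> sym_diff A B \<Longrightarrow> hamming A B = Suc (hamming (sym_diff A {c}) B)"
proof -
  have fin: "finite (sym_diff A B)" using assms by simp
  show "hamming (sym_diff A {c}) B = Suc (hamming A B)" if c: "c \<notin> sym_diff A B"
  proof -
    have "sym_diff (sym_diff A {c}) B = insert c (sym_diff A B)" using c by blast
    then show ?thesis unfolding hamming_def using c fin by (metis card_insert_disjoint)
  qed
  show "hamming A B = Suc (hamming (sym_diff A {c}) B)" if c: "c \<in> sym_diff A B"
  proof -
    have "sym_diff (sym_diff A {c}) B = sym_diff A B - {c}" using c by blast
    then show ?thesis unfolding hamming_def using c fin by (metis card_Suc_Diff1)
  qed
qed

text \<open>
  The coordinates in which two cube vertices agree are those that can be flipped to increase
  their distance.
\<close>

lemma unflipped_coordinates: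
  assumes "A \<subseteq> {..<l}" "B \<subseteq> {..<l}"
  shows "card ({..<l} - sym_diff A B) = l - hamming A B"
  unfolding hamming_def using assms by (subst card_Diff_subset) (auto intro: finite_subset)

definition vertex :: "nat set \<Rightarrow> nat \<Rightarrow> nat" where
  "vertex A w = prod_encode (set_encode A, w)"

definition cube_part :: "nat \<Rightarrow> nat set" where
  "cube_part u = set_decode (fst (prod_decode u))"

definition wheel_part :: "nat \<Rightarrow> nat" where
  "wheel_part u = snd (prod_decode u)"

lemma vertex_parts [simp]:
  "finite A \<Longrightarrow> cube_part (vertex A w) = A" "wheel_part (vertex A w) = w"
  "vertex (cube_part u) (wheel_part u) = u" "finite (cube_part u)"
  by (simp_all add: vertex_def cube_part_def wheel_part_def)

definition product_verts :: "nat \<Rightarrow> nat set" where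
  "product_verts l = {u. cube_part u \<subseteq> {..<l} \<and> wheel_part u < 7}"

definition product_dist :: "nat \<Rightarrow> nat \<Rightarrow> nat" where
  "product_dist u v = hamming (cube_part u) (cube_part v) + wheel_dist (wheel_part u) (wheel_part v)"

lemma vertex_in_product_verts [simp]:
  "finite A \<Longrightarrow> vertex A w \<in> product_verts l \<longleftrightarrow> A \<subseteq> {..<l} \<and> w < 7"
  by (simp add: product_verts_def)

lemma finite_product_verts: "finite (product_verts l)"
proof -
  have "u \<in> case_prod vertex ` (Pow {..<l} \<times> {..<7})" if "u \<in> product_verts l" for u
    using that by (intro image_eqI[of _ _ "(cube_part u, wheel_part u)"]) (auto simp: product_verts_def)
  then have "product_verts l \<subseteq> case_prod vertex ` (Pow {..<l} \<times> {..<7})" by blast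
  then show ?thesis by (rule finite_subset) simp
qed

interpretation product: geodesic_metric "product_verts l" product_dist for l
proof
  fix u v w
  show "finite (product_verts l)" by (rule finite_product_verts)
  show "product_dist u v = 0 \<longleftrightarrow> u = v"
    by (metis add_is_0 product_dist_def hamming_zero_iff vertex_parts(3,4) wheel_dist_zero_iff)
  show "product_dist u v = product_dist v u"
    by (simp add: product_dist_def hamming_sym wheel_dist_sym)
  show "product_dist u w \<le> product_dist u v + product_dist v w"
    using hamming_triangle[of "cube_part u" "cube_part v" "cube_part w"]
      wheel_dist_triangle[of "wheel_part u" "wheel_part w" "wheel_part v"]
    by (simp add: product_dist_def)
next
  fix u v assume uv: "u \<in> product_verts l" "v \<in> product_verts l" "u \<noteq> v"
  show "\<exists>w\<in>product_verts l. product_dist u w = 1 \<and> product_dist u v = Suc (product_dist w v)"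
  proof (cases "cube_part u = cube_part v")
    case True
    with uv have "wheel_part u \<noteq> wheel_part v" by (metis vertex_parts(3))
    moreover have "wheel_part v < 7" using uv by (simp add: product_verts_def)
    ultimately obtain k where "k < 7" "wheel_dist (wheel_part u) k = 1"
      "wheel_dist (wheel_part u) (wheel_part v) = Suc (wheel_dist k (wheel_part v))"
      using wheel_dist_step by blast
    then show ?thesis using uv True
      by (intro bexI[of _ "vertex (cube_part u) k"]) (auto simp: product_verts_def product_dist_def hamming_def)
  next
    case False
    then obtain c where c: "c \<in> sym_diff (cube_part u) (cube_part v)" by blast
    then have "c < l" using uv by (auto simp: product_verts_def)
    then show ?thesis using uv hamming_flip(2)[OF _ _ c] hamming_flip_self(1)
      by (intro bexI[of _ "vertex (sym_diff (cube_part u) {c}) (wheel_part u)"])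
        (auto simp: product_verts_def product_dist_def)
  qed
qed

lemma product_dist_le:
  assumes "u \<in> product_verts l" "v \<in> product_verts l"
  shows "product_dist u v \<le> l + 2"
  using assms hamming_le[of "cube_part u" l "cube_part v"] wheel_dist_le[of "wheel_part u" "wheel_part v"]
  by (simp add: product_verts_def product_dist_def)

text \<open>
  Here \<open>l = hamming A B + wheel_dist i j\<close>, so the number of coordinates in which \<open>A\<close> and \<open>B\<close> agree
  is exactly \<open>wheel_dist i j\<close>. According to its value 0, 1 or 2, both steps are made in the wheel, one
  in each factor, or both in the cube. In the middle case the wheel decides at which end its step
  is made (for a hub and a rim vertex, only the hub can move), and the other end flips
  the coordinate.
\<close>

lemma product_dist_widen:
  assumes p: "p \<in> product_verts l" and q: "q \<in> product_verts l" and pq: "product_dist p q = l"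
  shows "\<exists>u\<in>product_verts l. \<exists>v\<in>product_verts l.
           product_dist u p = 1 \<and> product_dist q v = 1 \<and> product_dist u v = l + 2"
proof -
  define A B i j where "A = cube_part p" and "B = cube_part q"
    and "i = wheel_part p" and "j = wheel_part q"
  have A: "A \<subseteq> {..<l}" "finite A" and B: "B \<subseteq> {..<l}" "finite B" and ij: "i < 7" "j < 7"
    using p q by (auto simp: A_def B_def i_def j_def product_verts_def)
  have d: "hamming A B + wheel_dist i j = l"
    using pq by (simp add: product_dist_def A_def B_def i_def j_def)
  have parts: "cube_part p = A" "cube_part q = B" "wheel_part p = i" "wheel_part q = j"
    by (simp_all add: A_def B_def i_def j_def)
  have free: "card ({..<l} - sym_diff A B) = wheel_dist i j"
    using unflipped_coordinates[OF A(1) B(1)] d by linarith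
  have witness: ?thesis
    if "A' \<subseteq> {..<l}" "B' \<subseteq> {..<l}" "i' < 7" "j' < 7"
      "hamming A' A + wheel_dist i' i = 1" "hamming B B' + wheel_dist j j' = 1"
      "hamming A' B' + wheel_dist i' j' = l + 2" for A' B' i' j'
    using that finite_subset[of A' "{..<l}"] finite_subset[of B' "{..<l}"]
    by (intro bexI[of _ "vertex A' i'"] bexI[of _ "vertex B' j'"]) (auto simp: product_dist_def parts)
  have flipA: "sym_diff A {c} \<subseteq> {..<l}" and flipB: "sym_diff B {c} \<subseteq> {..<l}" if "c < l" for c
    using that A B by auto
  have self: "hamming C C = 0" for C by (simp add: hamming_def)
  consider "wheel_dist i j = 0" | "wheel_dist i j = 1" | "wheel_dist i j = 2"
    using wheel_dist_le[of i j] by linarith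
  then show ?thesis
  proof cases
    case 1
    then have "i = j" by simp
    obtain k m where "k < 7" "m < 7" "wheel_dist k i = 1" "wheel_dist i m = 1" "wheel_dist k m = 2"
      using wheel_dist_widen_vertex[OF ij(1)] by blast
    then show ?thesis using witness[of A B k m] A B d self \<open>i = j\<close> by simp
  next
    case 2
    then obtain c where c: "c < l" "c \<notin> sym_diff A B"
      using free by (auto simp: card_1_singleton_iff set_eq_iff)
    from wheel_dist_widen_edge[OF ij 2] show ?thesis
    proof
      assume "\<exists>k<7. wheel_dist k i = 1 \<and> wheel_dist k j = 2"
      then obtain k where "k < 7" "wheel_dist k i = 1" "wheel_dist k j = 2" by blast
      moreover have "hamming A (sym_diff B {c}) = Suc (hamming A B)"
        using hamming_flip(1)[OF B(2) A(2), of c] c hamming_sym by (metis Un_commute)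
      ultimately show ?thesis
        using witness[of A "sym_diff B {c}" k j] A flipB[OF c(1)] d self hamming_flip_self 2 ij by simp
    next
      assume "\<exists>k<7. wheel_dist j k = 1 \<and> wheel_dist i k = 2"
      then obtain k where "k < 7" "wheel_dist j k = 1" "wheel_dist i k = 2" by blast
      moreover have "hamming (sym_diff A {c}) B = Suc (hamming A B)"
        using hamming_flip(1)[OF A(2) B(2) c(2)] .
      ultimately show ?thesis
        using witness[of "sym_diff A {c}" B i k] B flipA[OF c(1)] d self hamming_flip_self 2 ij by simp
    qed
  next
    case 3
    then obtain c e where "{..<l} - sym_diff A B = {c, e}" "c \<noteq> e"
      using free by (auto simp: card_2_iff)
    then have ce: "c < l" "c \<notin> sym_diff A B" "e < l" "e \<notin> sym_diff A B" "c \<noteq> e" by auto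
    have "e \<notin> sym_diff B (sym_diff A {c})" using ce by blast
    then have "hamming (sym_diff B {e}) (sym_diff A {c}) = Suc (hamming B (sym_diff A {c}))"
      by (rule hamming_flip(1)[OF B(2) finite_subset[OF flipA[OF ce(1)] finite_lessThan]])
    moreover have "hamming (sym_diff A {c}) B = Suc (hamming A B)"
      using hamming_flip(1)[OF A(2) B(2) ce(2)] .
    ultimately have "hamming (sym_diff A {c}) (sym_diff B {e}) = Suc (Suc (hamming A B))"
      using hamming_sym by metis
    then show ?thesis
      using witness[of "sym_diff A {c}" "sym_diff B {e}" i j] flipA[OF ce(1)] flipB[OF ce(3)] d
        hamming_flip_self 3 ij by simp
  qed
qed

text \<open>
  The cycle is read as a periodic sequence \<open>x\<close> of vertices with wheel projection \<open>W\<close>. At the times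
  \<open>0\<close>, \<open>t\<close>, \<open>D\<close>, \<open>t + D\<close> and \<open>2 * D\<close>, where \<open>t\<close> is the time of the first move, the projection visits
  five rim vertices as in \<open>wheel_no_short_antipodal_walk\<close>.
\<close>

lemma isometric_cycle_diameter:
  assumes cyc: "isometric_cycle (product.unit_graph l) cs fs" and ij: "i < length cs" "j < length cs"
  shows "product_dist (cs ! i) (cs ! j) \<le> l + 1"
proof (rule ccontr)
  assume far: "\<not> ?thesis"
  define n where "n = length cs"
  define D where "D = l + 2"
  define x where "x k = cs ! (k mod n)" for k
  define W where "W k = wheel_part (x k)" for k
  define h where "h k m = hamming (cube_part (x k)) (cube_part (x m))" for k m
  have n: "n > 0" using ij by (auto simp: n_def)
  have D: "D > 0" by (simp add: D_def)
  have xV: "x k \<in> product_verts l" for k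
    using cyc n nth_mem[of "k mod n" cs]
    by (auto simp: isometric_cycle_def is_cycle_def x_def n_def)
  have dist: "product_dist (x k) (x m) = cyc_dist n k m" for k m
    using product.isometric_cycle_dist[OF cyc, of "k mod n" "m mod n"] n
    by (simp add: x_def n_def cyc_dist_mod)
  have split: "product_dist (x k) (x m) = h k m + wheel_dist (W k) (W m)" for k m
    by (simp add: product_dist_def h_def W_def)
  have "cyc_dist n i j \<ge> D"
    using far product.isometric_cycle_dist[OF cyc ij] by (simp add: n_def D_def)
  then have lower: "2 * D \<le> n" using cyc_dist_le_half[of n i j] by linarith
  have upper: "n \<le> 2 * D + 1"
  proof (rule ccontr)
    assume "\<not> n \<le> 2 * D + 1"
    then have "product_dist (x (D + 1)) (x 0) = D + 1"
      using dist[of "D + 1" 0] cyc_dist_add[of "D + 1" n 0] n by simp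
    then show False using product_dist_le[OF xV[of "D + 1"] xV[of 0]] by (simp add: D_def)
  qed
  have window: "product_dist (x k) (x m) = m - k" if "k \<le> m" "m \<le> k + D" for k m
    using dist[of m k] cyc_dist_add[of "m - k" n k] product.sym[of "x k" "x m"] that lower n by simp
  \<comment> \<open>On a geodesic of the product the triangle inequality is tight in each factor.\<close>
  have straight: "wheel_dist (W k) (W s) + wheel_dist (W s) (W m) = wheel_dist (W k) (W m)"
    if "k \<le> s" "s \<le> m" "m \<le> k + D" for k s m
  proof -
    have "h k s + wheel_dist (W k) (W s) + (h s m + wheel_dist (W s) (W m))
        = h k m + wheel_dist (W k) (W m)"
      using window[of k s] window[of s m] window[of k m] that by (simp add: split)
    moreover have "h k m \<le> h k s + h s m" unfolding h_def by (rule hamming_triangle) simp_all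
    ultimately show ?thesis using wheel_dist_triangle[of "W k" "W m" "W s"] by linarith
  qed
  \<comment> \<open>Vertices at distance \<open>D\<close> are as far apart as possible in each factor.\<close>
  have antipodal: "wheel_dist (W k) (W (k + D)) = 2" for k
  proof -
    have "h k (k + D) \<le> l"
      unfolding h_def using xV by (intro hamming_le) (auto simp: product_verts_def)
    then show ?thesis
      using window[of k "k + D"] wheel_dist_le[of "W k" "W (k + D)"] by (simp add: split D_def)
  qed
  obtain t where t: "t \<le> D" "wheel_dist (W 0) (W t) = 1"
  proof -
    define t where "t = (LEAST t. W t \<noteq> W 0)"
    have ne: "W D \<noteq> W 0" using antipodal[of 0] by auto
    have t1: "W t \<noteq> W 0" and t2: "t \<le> D"
      unfolding t_def using ne by (rule LeastI, rule Least_le)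
    then obtain s where s: "t = Suc s" by (cases t) auto
    then have "W s = W 0" using not_less_Least[of s "\<lambda>t. W t \<noteq> W 0"] by (auto simp: t_def)
    moreover have "wheel_dist (W s) (W t) \<le> 1"
      using window[of s t] split[of s t] s D by simp
    ultimately have "wheel_dist (W 0) (W t) = 1"
      using t1 wheel_dist_zero_iff[of "W 0" "W t"] by (metis One_nat_def le_Suc_eq le_zero_eq)
    with t2 show ?thesis by (rule that)
  qed
  have less: "W k < 7" for k using xV[of k] by (simp add: W_def product_verts_def)
  have b_c: "wheel_dist (W t) (W D) = 1" using straight[of 0 t D] t antipodal[of 0] by simp
  have c_d: "wheel_dist (W D) (W (t + D)) = 1"
    using straight[of t D "t + D"] t antipodal[of t] b_c by simp
  have d_e: "wheel_dist (W (t + D)) (W (D + D)) = 1"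
    using straight[of D "t + D" "D + D"] t antipodal[of D] c_d by simp
  have "wheel_dist (W 0) (W (D + D)) = 2"
    using wheel_no_short_antipodal_walk[OF less less less less less t(2) b_c c_d d_e]
      antipodal[of 0] antipodal[of t] antipodal[of D] by simp
  moreover have "product_dist (x (D + D)) (x 0) \<le> 1"
    using dist[of "D + D" 0] cyc_dist_add[of "D + D" n 0] lower upper n by simp
  ultimately show False using split[of "D + D" 0] wheel_dist_sym[of "W 0"] by simp
qed

theorem theorem6:
  fixes l :: nat
  shows "\<exists>G :: (nat, nat) multigraph.
           finite_graph G \<and>
           (\<exists>vs es. isometric_path G vs es \<and> length es = l) \<and>
           \<not> (\<exists>vs es. avoidable G vs es \<and> length es = l)"
proof (intro exI[of _ "product.unit_graph l"] conjI notI)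
  show "finite_graph (product.unit_graph l)" by (rule product.finite_unit_graph)
  have "product_dist (vertex {} 0) (vertex {..<l} 0) = l"
    by (simp add: product_dist_def hamming_def)
  then show "\<exists>vs es. isometric_path (product.unit_graph l) vs es \<and> length es = l"
    using product.isometric_path_exists[of "vertex {} 0" l "vertex {..<l} 0"] by simp
next
  assume "\<exists>vs es. avoidable (product.unit_graph l) vs es \<and> length es = l"
  then obtain vs es where av: "avoidable (product.unit_graph l) vs es" and l: "length es = l" by blast
  then have iso: "isometric_path (product.unit_graph l) vs es" by (simp add: avoidable_def)
  then have p: "is_path (product.unit_graph l) vs es" by (simp add: isometric_path_def)
  then have "set vs \<subseteq> product_verts l" "vs \<noteq> []" by (auto simp: is_path_def)
  then have "hd vs \<in> product_verts l" "last vs \<in> product_verts l" by auto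
  moreover have "product_dist (hd vs) (last vs) = l"
    using product.isometric_path_iff_endpoints[OF p] iso l by simp
  ultimately obtain u v where uv: "u \<in> product_verts l" "v \<in> product_verts l"
    "product_dist u (hd vs) = 1" "product_dist (last vs) v = 1" "product_dist u v = l + 2"
    using product_dist_widen by blast
  then obtain e f where ext:
    "isometric_extension (product.unit_graph l) vs es (u # vs @ [v]) (e # es @ [f])"
    using product.isometric_extension_exists[OF iso] l by blast
  with av have "closable (product.unit_graph l) (u # vs @ [v]) (e # es @ [f])"
    by (simp add: avoidable_def)
  then obtain cs fs i j where "isometric_cycle (product.unit_graph l) cs fs" "i < length cs" "j < length cs"
    "l + 2 = product_dist (cs ! i) (cs ! j)"
    using product.closable_endpoints l by fastforce
  then show False using isometric_cycle_diameter by fastforce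
qed

end
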